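(* Let $\mathcal{S}$ be a federated Byzantine quorum system over $\mathbf{V}$ with quorum intersection. Then the Stellar broadcast over $\mathcal{S}$ satisfies the specification of weakly reliable Byzantine broadcast (Validity for intact servers, No duplication, Integrity, Consistency, and Totality for intact servers) in every execution in which at least one server in $\mathcal{S}$ is intact.
   Context: System model. There is a set of clients $\mathbf{C}$ and a disjoint finite non-empty set of servers $\mathbf{V}$. In an execution each node (client or server) is either correct (follows its protocol) or faulty (Byzantine: behaves arbitrarily). One distinguished client $c$ is the sender; it may be correct or faulty. Any two nodes communicate over an asynchronous point-to-point channel. If both endpoints are correct, the channel is authenticated and reliable: a correct node receives (eventually, after an arbitrary finite delay) a message from another correct node if and only if the latter sent it. Servers also send messages to themselves. Executions are complete: a handler of a correct server that stays enabled is eventually executed. A correct sender broadcasts at most one value. All servers act according to the same FBQS $\mathcal{S}$. Federated Byzantine quorum system (FBQS) over $\mathbf{V}$: a function $\mathcal{S}$ assigning to each $v\in\mathbf{V}$ a non-empty set $\mathcal{S}(v)\subseteq 2^{\mathbf{V}}$ of quorum slices, with $v\in q$ for all $q\in\mathcal{S}(v)$. A non-empty $U\subseteq\mathbf{V}$ is a quorum in $\mathcal{S}$ if $\forall v\in U.\ \exists q\in\mathcal{S}(v).\ q\subseteq U$; let $\mathcal{Q}$ be the set of all quorums in $\mathcal{S}$. $\mathcal{S}$ has quorum intersection if any two of its quorums intersect. For $I\subseteq\mathbf{V}$, $\mathcal{S}|_I$ is the FBQS over universe $I$ with $\mathcal{S}|_I(v)=\{q\cap I\mid q\in\mathcal{S}(v)\}$.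 Given the set of faulty servers $\mathbf{V}_{\mathrm{bad}}$, the set $\mathbf{V}_{\mathrm{int}}$ of intact servers in $\mathcal{S}$ is the biggest set such that $\mathbf{V}_{\mathrm{int}}\cap\mathbf{V}_{\mathrm{bad}}=\emptyset$; if $\mathbf{V}_{\mathrm{int}}$ is non-empty then it is a quorum in $\mathcal{S}$; and $\mathcal{S}|_{\mathbf{V}_{\mathrm{int}}}$ has quorum intersection. (For FBQSes with quorum intersection this set exists and is unique.) A set $B\subseteq\mathbf{V}$ is $v$-blocking if $q\cap B\neq\emptyset$ for every $q\in\mathcal{S}(v)$. Stellar broadcast over $\mathcal{S}$. To broadcast a value $a$, the sender $c$ sends $\mathtt{BCAST}(a)$ to every server. Each server $v$ has Boolean variables echoed, ready, delivered, all initially false, and the following handlers. (1) When $v$ has received $\mathtt{BCAST}(a)$ from $c$ and echoed is false: set echoed to true and send $\mathtt{ECHO}(a)$ to every server. (2) When $v$ has received $\mathtt{ECHO}(a)$ from every $u\in U$ for some $U\in\mathcal{Q}$ such that $v\in U$, and ready is false: set ready to true and send $\mathtt{READY}(a)$ to every server. (3) When $v$ has received $\mathtt{READY}(a)$ from every $u\in B$ for some non-empty $v$-blocking $B\subseteq\mathbf{V}$, and ready is false: set ready to true and send $\mathtt{READY}(a)$ to every server. (4) When $v$ has received $\mathtt{READY}(a)$ from every $u\in U$ for some $U\in\mathcal{Q}$ such that $v\in U$, and delivered is false: set delivered to true and deliver $a$. Weakly reliable Byzantine broadcast. Validity for intact servers: if the sender is correct and broadcasts a value $a$, then every intact server eventually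 delivers $a$. No duplication: every correct server delivers at most one value. Integrity: if some correct server delivers a value $a$ and the sender is correct, then $a$ was previously broadcast by the sender. Consistency: if some correct server delivers $a$ and another correct server delivers $a'$, then $a=a'$. Totality for intact servers: if a correct server delivers a value, then every intact server eventually delivers a value. *)

theory Defs
  imports Main
begin

type_synonym 'n slices = "'n \<Rightarrow> 'n set set"

text \<open>The universe is an explicit argument throughout; the values of a slice function
  outside the universe are irrelevant.\<close>

definition fbqs :: "'n set \<Rightarrow> 'n slices \<Rightarrow> bool" where
  "fbqs V S \<longleftrightarrow> (\<forall>v\<in>V. S v \<noteq> {} \<and> (\<forall>q\<in>S v. q \<subseteq> V \<and> v \<in> q))"

definition quorum :: "'n set \<Rightarrow> 'n slices \<Rightarrow> 'n set \<Rightarrow> bool" where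
  "quorum V S U \<longleftrightarrow> U \<noteq> {} \<and> U \<subseteq> V \<and> (\<forall>v\<in>U. \<exists>q\<in>S v. q \<subseteq> U)"

definition quorum_intersection :: "'n set \<Rightarrow> 'n slices \<Rightarrow> bool" where
  "quorum_intersection V S \<longleftrightarrow>
     (\<forall>U U'. quorum V S U \<longrightarrow> quorum V S U' \<longrightarrow> U \<inter> U' \<noteq> {})"

definition projection :: "'n slices \<Rightarrow> 'n set \<Rightarrow> 'n slices" where
  "projection S I = (\<lambda>v. {q \<inter> I |q. q \<in> S v})"

definition blocking :: "'n slices \<Rightarrow> 'n \<Rightarrow> 'n set \<Rightarrow> bool" where
  "blocking S v B \<longleftrightarrow> (\<forall>q\<in>S v. q \<inter> B \<noteq> {})"

definition intact_candidate :: "'n set \<Rightarrow> 'n slices \<Rightarrow> 'n set \<Rightarrow> 'n set \<Rightarrow> bool" where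
  "intact_candidate V S Vbad I \<longleftrightarrow>
     I \<subseteq> V \<and> I \<inter> Vbad = {} \<and> (I \<noteq> {} \<longrightarrow> quorum V S I) \<and>
     quorum_intersection I (projection S I)"

text \<open>The greatest candidate with respect to inclusion. It exists when the quorum system
  over a finite universe has quorum intersection, as shown in \<open>intact_greatest\<close> below.\<close>

definition intact :: "'n set \<Rightarrow> 'n slices \<Rightarrow> 'n set \<Rightarrow> 'n set" where
  "intact V S Vbad = (GREATEST I. intact_candidate V S Vbad I)"

lemma quorum_restrict:
  assumes "quorum K (projection S K) U" "I \<subseteq> K" "U \<inter> I \<noteq> {}"
  shows "quorum I (projection S I) (U \<inter> I)"
  unfolding quorum_def
proof (intro conjI ballI)
  fix v assume v: "v \<in> U \<inter> I"
  then obtain q where q: "q \<in> S v" "q \<inter> K \<subseteq> U"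
    using assms(1) unfolding quorum_def projection_def by blast
  then have "q \<inter> I \<subseteq> U \<inter> I" using assms(2) by blast
  then show "\<exists>q\<in>projection S I v. q \<subseteq> U \<inter> I"
    using q unfolding projection_def by blast
qed (use assms in auto)

lemma quorum_projection:
  assumes "quorum V S U" "U \<inter> I \<noteq> {}"
  shows "quorum I (projection S I) (U \<inter> I)"
  unfolding quorum_def
proof (intro conjI ballI)
  fix v assume v: "v \<in> U \<inter> I"
  then obtain q where "q \<in> S v" "q \<subseteq> U"
    using assms(1) unfolding quorum_def by blast
  then show "\<exists>q\<in>projection S I v. q \<subseteq> U \<inter> I"
    unfolding projection_def by blast
qed (use assms in auto)

lemma intact_candidate_Un:
  assumes qi: "quorum_intersection V S"
    and I: "intact_candidate V S Vbad I" and J: "intact_candidate V S Vbad J"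
  shows "intact_candidate V S Vbad (I \<union> J)"
proof (cases "I = {} \<or> J = {}")
  case True
  then show ?thesis using I J by auto
next
  case False
  then have qI: "quorum V S I" and qJ: "quorum V S J"
    using I J unfolding intact_candidate_def by auto
  have IJ: "J \<inter> I \<noteq> {}" using qi qI qJ unfolding quorum_intersection_def by blast
  have qK: "quorum V S (I \<union> J)"
    using qI qJ unfolding quorum_def by (auto; meson le_supI1 le_supI2)
  have meets: "U \<inter> I \<noteq> {}" if U: "quorum (I \<union> J) (projection S (I \<union> J)) U" for U
  proof (rule ccontr)
    assume n: "\<not> U \<inter> I \<noteq> {}"
    then have "U \<inter> J \<noteq> {}" using U unfolding quorum_def by blast
    then have "quorum J (projection S J) (U \<inter> J)"
      by (intro quorum_restrict[OF U]) auto
    moreover have "quorum J (projection S J) (I \<inter> J)"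
      using quorum_projection[OF qI] IJ by blast
    ultimately have "(U \<inter> J) \<inter> (I \<inter> J) \<noteq> {}"
      using J unfolding intact_candidate_def quorum_intersection_def by blast
    then show False using n by blast
  qed
  have "quorum_intersection (I \<union> J) (projection S (I \<union> J))"
    unfolding quorum_intersection_def
  proof (intro allI impI)
    fix U U'
    assume "quorum (I \<union> J) (projection S (I \<union> J)) U"
      "quorum (I \<union> J) (projection S (I \<union> J)) U'"
    then have "quorum I (projection S I) (U \<inter> I)" "quorum I (projection S I) (U' \<inter> I)"
      using meets by (auto intro!: quorum_restrict)
    then have "(U \<inter> I) \<inter> (U' \<inter> I) \<noteq> {}"
      using I unfolding intact_candidate_def quorum_intersection_def by blast
    then show "U \<inter> U' \<noteq> {}" by blast
  qed
  then show ?thesis using I J qK unfolding intact_candidate_def by auto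
qed

lemma intact_greatest:
  assumes "finite V" "quorum_intersection V S"
  shows "intact_candidate V S Vbad (intact V S Vbad)"
    and "intact_candidate V S Vbad J \<Longrightarrow> J \<subseteq> intact V S Vbad"
proof -
  let ?P = "intact_candidate V S Vbad"
  have "finite {I. ?P I}"
    by (rule finite_subset[of _ "Pow V"]) (use assms in \<open>auto simp: intact_candidate_def\<close>)
  moreover have "?P {}"
    by (auto simp: intact_candidate_def quorum_intersection_def quorum_def)
  ultimately obtain M where M: "?P M" "\<And>I. ?P I \<Longrightarrow> M \<subseteq> I \<Longrightarrow> I = M"
    using finite_has_maximal[of "{I. ?P I}"] by auto
  have greatest: "I \<subseteq> M" if "?P I" for I
    using M(2)[OF intact_candidate_Un[OF assms(2) M(1) that]] by blast
  have "intact V S Vbad = M"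
    unfolding intact_def using M(1) greatest by (intro Greatest_equality) auto
  then show "?P (intact V S Vbad)" and "?P J \<Longrightarrow> J \<subseteq> intact V S Vbad"
    using M(1) greatest by auto
qed

datatype 'a msg = BCAST 'a | ECHO 'a | READY 'a

text \<open>\<open>rcvd\<close> contains \<open>(u, m)\<close> iff message \<open>m\<close> has been received on the channel from \<open>u\<close>;
  \<open>sent\<close> contains \<open>(u, w, m)\<close> iff \<open>u\<close> has sent \<open>m\<close> to \<open>w\<close>.\<close>

record ('n, 'a) node_state =
  echoed :: bool
  ready :: bool
  delivered :: bool
  rcvd :: "('n \<times> 'a msg) set"

record ('n, 'a) state =
  node :: "'n \<Rightarrow> ('n, 'a) node_state"
  sent :: "('n \<times> 'n \<times> 'a msg) set"

definition init :: "('n, 'a) state" where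
  "init = \<lparr>node = (\<lambda>v. \<lparr>echoed = False, ready = False, delivered = False, rcvd = {}\<rparr>),
           sent = {}\<rparr>"

datatype handler = Echo | Ready_Quorum | Ready_Blocking | Deliver

fun enabled ::
  "'n set \<Rightarrow> 'n \<Rightarrow> 'n slices \<Rightarrow> 'n \<Rightarrow> handler \<Rightarrow> 'a \<Rightarrow> ('n, 'a) node_state \<Rightarrow> bool" where
  "enabled V c S v Echo a l \<longleftrightarrow> (c, BCAST a) \<in> rcvd l \<and> \<not> echoed l"
| "enabled V c S v Ready_Quorum a l \<longleftrightarrow>
     (\<exists>U. quorum V S U \<and> v \<in> U \<and> (\<forall>u\<in>U. (u, ECHO a) \<in> rcvd l)) \<and> \<not> ready l"
| "enabled V c S v Ready_Blocking a l \<longleftrightarrow>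
     (\<exists>B. B \<noteq> {} \<and> B \<subseteq> V \<and> blocking S v B \<and> (\<forall>u\<in>B. (u, READY a) \<in> rcvd l)) \<and> \<not> ready l"
| "enabled V c S v Deliver a l \<longleftrightarrow>
     (\<exists>U. quorum V S U \<and> v \<in> U \<and> (\<forall>u\<in>U. (u, READY a) \<in> rcvd l)) \<and> \<not> delivered l"

fun update :: "handler \<Rightarrow> ('n, 'a) node_state \<Rightarrow> ('n, 'a) node_state" where
  "update Echo l = l\<lparr>echoed := True\<rparr>"
| "update Ready_Quorum l = l\<lparr>ready := True\<rparr>"
| "update Ready_Blocking l = l\<lparr>ready := True\<rparr>"
| "update Deliver l = l\<lparr>delivered := True\<rparr>"

fun outgoing :: "handler \<Rightarrow> 'a \<Rightarrow> 'a msg set" where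
  "outgoing Echo a = {ECHO a}"
| "outgoing Ready_Quorum a = {READY a}"
| "outgoing Ready_Blocking a = {READY a}"
| "outgoing Deliver a = {}"

text \<open>\<open>Receive u v m\<close>: node \<open>v\<close> receives \<open>m\<close> on the channel from \<open>u\<close>.
  \<open>Exec v h a\<close>: server \<open>v\<close> executes handler \<open>h\<close> for value \<open>a\<close>; in particular
  \<open>Exec v Deliver a\<close> is the delivery of \<open>a\<close> by \<open>v\<close>.
  \<open>Idle\<close> allows a finite execution to be represented by an infinite sequence.\<close>

datatype ('n, 'a) event =
  Broadcast 'a
| Receive 'n 'n "'a msg"
| Exec 'n handler 'a
| Byzantine 'n
| Idle

text \<open>A node is faulty if it belongs to \<open>F\<close>. Reception is constrained only if both endpoints
  are correct: a correct node may receive anything on a channel from a faulty node, but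
  nothing can be forged on a channel between correct nodes.\<close>

inductive step ::
  "'n set \<Rightarrow> 'n set \<Rightarrow> 'n \<Rightarrow> 'n slices \<Rightarrow> 'n set \<Rightarrow>
   ('n, 'a) state \<Rightarrow> ('n, 'a) event \<Rightarrow> ('n, 'a) state \<Rightarrow> bool"
  for C V :: "'n set" and c :: 'n and S :: "'n slices" and F :: "'n set" where
  broadcast:
    "c \<notin> F \<Longrightarrow>
     step C V c S F s (Broadcast a) (s\<lparr>sent := sent s \<union> {c} \<times> V \<times> {BCAST a}\<rparr>)"
| receive:
    "u \<in> C \<union> V \<Longrightarrow> v \<in> C \<union> V \<Longrightarrow>
     (u \<notin> F \<and> v \<notin> F \<longrightarrow> (u, v, m) \<in> sent s) \<Longrightarrow>
     step C V c S F s (Receive u v m)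
       (s\<lparr>node := (node s)(v := (node s v)\<lparr>rcvd := insert (u, m) (rcvd (node s v))\<rparr>)\<rparr>)"
| exec:
    "v \<in> V - F \<Longrightarrow> enabled V c S v h a (node s v) \<Longrightarrow>
     step C V c S F s (Exec v h a)
       \<lparr>node = (node s)(v := update h (node s v)),
        sent = sent s \<union> {v} \<times> V \<times> outgoing h a\<rparr>"
| byzantine:
    "u \<in> F \<Longrightarrow>
     step C V c S F s (Byzantine u)
       \<lparr>node = (node s)(u := l), sent = sent s \<union> {u} \<times> X\<rparr>"
| idle:
    "step C V c S F s Idle s"

text \<open>Completeness is weak fairness for each instance of a handler, given by the server and
  the value. The two \<open>Broadcast\<close> events in the last conjunct may carry the same value: only
  distinct values are excluded.\<close>

definition stellar_execution ::
  "'n set \<Rightarrow> 'n set \<Rightarrow> 'n \<Rightarrow> 'n slices \<Rightarrow> 'n set \<Rightarrow>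
   (nat \<Rightarrow> ('n, 'a) state) \<Rightarrow> (nat \<Rightarrow> ('n, 'a) event) \<Rightarrow> bool" where
  "stellar_execution C V c S F \<sigma> ev \<longleftrightarrow>
     \<sigma> 0 = init \<and>
     (\<forall>i. step C V c S F (\<sigma> i) (ev i) (\<sigma> (Suc i))) \<and>
     (\<forall>u \<in> (C \<union> V) - F. \<forall>v \<in> (C \<union> V) - F. \<forall>m i.
        (u, v, m) \<in> sent (\<sigma> i) \<longrightarrow> (\<exists>j. ev j = Receive u v m)) \<and>
     (\<forall>v \<in> V - F. \<forall>h a i.
        (\<forall>j\<ge>i. enabled V c S v h a (node (\<sigma> j) v)) \<longrightarrow> (\<exists>j\<ge>i. ev j = Exec v h a)) \<and>
     (c \<notin> F \<longrightarrow> (\<forall>i j a b. ev i = Broadcast a \<longrightarrow> ev j = Broadcast b \<longrightarrow> a = b))"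

text \<open>\<open>I\<close> is the set of intact servers. The event index is the time; in an execution, which
  is infinite, an event happens eventually iff it occurs at some index.\<close>

definition validity_for_intact ::
  "'n \<Rightarrow> 'n set \<Rightarrow> 'n set \<Rightarrow> (nat \<Rightarrow> ('n, 'a) event) \<Rightarrow> bool" where
  "validity_for_intact c F I ev \<longleftrightarrow>
     (\<forall>i a. c \<notin> F \<longrightarrow> ev i = Broadcast a \<longrightarrow> (\<forall>v\<in>I. \<exists>j. ev j = Exec v Deliver a))"

definition no_duplication ::
  "'n set \<Rightarrow> 'n set \<Rightarrow> (nat \<Rightarrow> ('n, 'a) event) \<Rightarrow> bool" where
  "no_duplication V F ev \<longleftrightarrow>
     (\<forall>v \<in> V - F. \<forall>i j a b.
        ev i = Exec v Deliver a \<longrightarrow> ev j = Exec v Deliver b \<longrightarrow> i = j)"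

definition integrity ::
  "'n set \<Rightarrow> 'n \<Rightarrow> 'n set \<Rightarrow> (nat \<Rightarrow> ('n, 'a) event) \<Rightarrow> bool" where
  "integrity V c F ev \<longleftrightarrow>
     (\<forall>v \<in> V - F. \<forall>i a.
        ev i = Exec v Deliver a \<longrightarrow> c \<notin> F \<longrightarrow> (\<exists>j<i. ev j = Broadcast a))"

definition consistency ::
  "'n set \<Rightarrow> 'n set \<Rightarrow> (nat \<Rightarrow> ('n, 'a) event) \<Rightarrow> bool" where
  "consistency V F ev \<longleftrightarrow>
     (\<forall>v \<in> V - F. \<forall>v' \<in> V - F. \<forall>i i' a a'.
        ev i = Exec v Deliver a \<longrightarrow> ev i' = Exec v' Deliver a' \<longrightarrow> a = a')"

definition totality_for_intact ::
  "'n set \<Rightarrow> 'n set \<Rightarrow> 'n set \<Rightarrow> (nat \<Rightarrow> ('n, 'a) event) \<Rightarrow> bool" where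
  "totality_for_intact V F I ev \<longleftrightarrow>
     (\<forall>v \<in> V - F. \<forall>i a.
        ev i = Exec v Deliver a \<longrightarrow> (\<forall>w\<in>I. \<exists>j b. ev j = Exec w Deliver b))"

definition weakly_reliable_byzantine_broadcast ::
  "'n set \<Rightarrow> 'n \<Rightarrow> 'n slices \<Rightarrow> 'n set \<Rightarrow> (nat \<Rightarrow> ('n, 'a) event) \<Rightarrow> bool" where
  "weakly_reliable_byzantine_broadcast V c S F ev \<longleftrightarrow>
     validity_for_intact c F (intact V S (F \<inter> V)) ev \<and>
     no_duplication V F ev \<and>
     integrity V c F ev \<and>
     consistency V F ev \<and>
     totality_for_intact V F (intact V S (F \<inter> V)) ev"

end

theory Submission
  imports Defs
begin

text \<open>Every quorum meets the intact set \<open>I\<close>, and the traces on \<open>I\<close> of any two quorums intersect.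
  A blocking set of an intact server contains an intact server, because \<open>I\<close> is a quorum; hence the
  first intact server to send \<open>READY(a)\<close> has heard \<open>ECHO(a)\<close> from a quorum. Any two such echo quorums
  share an intact server, which echoes only once, so intact servers are ready for one value only, and
  this value was broadcast if the sender is correct. For totality, let \<open>R\<close> be the set of intact servers
  that ever become ready. No intact server outside \<open>R\<close> is blocked by \<open>R\<close>, so \<open>I - R\<close>, if
  non-empty, is a quorum of the projection to \<open>I\<close>. It would be disjoint from the trace on \<open>I\<close>
  of the quorum behind the first delivery, which lies in \<open>R\<close>.\<close>

section \<open>Blocking sets and traces of quorums\<close>

lemma blocking_meets_quorum:
  assumes "quorum V S U" "v \<in> U" "blocking S v B"
  shows "B \<inter> U \<noteq> {}"
proof -
  obtain q where "q \<in> S v" "q \<subseteq> U"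
    using assms(1,2) unfolding quorum_def by blast
  then show ?thesis using assms(3) unfolding blocking_def by blast
qed

text \<open>A server that \<open>R\<close> does not block has a slice missing \<open>R\<close>, and
  the trace of this slice on \<open>I\<close> stays inside \<open>I - R\<close>.\<close>

lemma quorum_projection_Diff:
  assumes "\<And>v. v \<in> I - R \<Longrightarrow> \<not> blocking S v R" "I - R \<noteq> {}"
  shows "quorum I (projection S I) (I - R)"
  unfolding quorum_def
proof (intro conjI ballI)
  fix v assume "v \<in> I - R"
  then obtain q where "q \<in> S v" "q \<inter> R = {}"
    using assms(1) unfolding blocking_def by blast
  then show "\<exists>q\<in>projection S I v. q \<subseteq> I - R"
    unfolding projection_def by blast
qed (use assms in auto)

section \<open>Single executions: events, messages and flags\<close>

locale stellar =
  fixes C V F :: "'n set" and c :: 'n and S :: "'n slices"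
    and \<sigma> :: "nat \<Rightarrow> ('n, 'a) state" and ev :: "nat \<Rightarrow> ('n, 'a) event"
  assumes disjoint: "C \<inter> V = {}" and finite_V: "finite V" and sender: "c \<in> C"
    and execution: "stellar_execution C V c S F \<sigma> ev"
begin

text \<open>The two handlers are merged because they share the flag \<open>ready\<close> and send
  the same message.\<close>

definition readies :: "nat \<Rightarrow> 'n \<Rightarrow> 'a \<Rightarrow> bool" where
  "readies i v a \<longleftrightarrow> ev i = Exec v Ready_Quorum a \<or> ev i = Exec v Ready_Blocking a"

lemma initial: "\<sigma> 0 = init"
  using execution unfolding stellar_execution_def by blast

lemma step_at: "step C V c S F (\<sigma> i) (ev i) (\<sigma> (Suc i))"
  using execution unfolding stellar_execution_def by blast

lemma reliable:
  "u \<in> (C \<union> V) - F \<Longrightarrow> v \<in> (C \<union> V) - F \<Longrightarrow> (u, v, m) \<in> sent (\<sigma> i) \<Longrightarrow>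
    \<exists>j. ev j = Receive u v m"
  using execution unfolding stellar_execution_def by blast

lemma fair:
  "v \<in> V - F \<Longrightarrow> (\<And>j. j \<ge> i \<Longrightarrow> enabled V c S v h a (node (\<sigma> j) v)) \<Longrightarrow>
    \<exists>j. ev j = Exec v h a"
  using execution unfolding stellar_execution_def by blast

lemma broadcast_unique:
  "c \<notin> F \<Longrightarrow> ev i = Broadcast a \<Longrightarrow> ev j = Broadcast b \<Longrightarrow> a = b"
  using execution unfolding stellar_execution_def by blast

lemma sender_not_server: "c \<notin> V"
  using disjoint sender by blast

lemma exec_enabled:
  assumes "ev i = Exec v h a"
  shows "v \<in> V - F" "enabled V c S v h a (node (\<sigma> i) v)"
  using step_at[of i] assms by (auto elim: step.cases)

lemma sent_mono: "i \<le> j \<Longrightarrow> sent (\<sigma> i) \<subseteq> sent (\<sigma> j)"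
proof (induction rule: dec_induct)
  case (step k)
  have "sent (\<sigma> k) \<subseteq> sent (\<sigma> (Suc k))"
    using step_at[of k] by (cases rule: step.cases) auto
  with step show ?case by blast
qed simp

text \<open>Handlers alter flags only. Faulty nodes are excluded since a \<open>Byzantine\<close>
  step may replace the whole local state, including \<open>rcvd\<close>.\<close>

lemma rcvd_mono:
  assumes "v \<notin> F"
  shows "i \<le> j \<Longrightarrow> rcvd (node (\<sigma> i) v) \<subseteq> rcvd (node (\<sigma> j) v)"
proof (induction rule: dec_induct)
  case (step k)
  have upd: "rcvd (update h l) = rcvd l" for h and l :: "('n, 'a) node_state"
    by (cases h) auto
  have "rcvd (node (\<sigma> k) v) \<subseteq> rcvd (node (\<sigma> (Suc k)) v)"
    using step_at[of k] by (cases rule: step.cases) (use assms in \<open>auto simp: upd\<close>)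
  with step show ?case by blast
qed simp

lemma exec_sends:
  assumes "ev i = Exec v h a" "m \<in> outgoing h a" "w \<in> V"
  shows "(v, w, m) \<in> sent (\<sigma> (Suc i))"
  using step_at[of i] by (cases rule: step.cases) (use assms in auto)

lemma broadcast_sends:
  assumes "ev i = Broadcast a" "w \<in> V"
  shows "(c, w, BCAST a) \<in> sent (\<sigma> (Suc i))"
  using step_at[of i] by (cases rule: step.cases) (use assms in auto)

text \<open>Messages of \<open>u\<close> enter \<open>sent\<close> only through its own handlers:
  \<open>Byzantine\<close> steps add messages of faulty nodes, and \<open>Broadcast\<close> adds
  those of \<open>c\<close>, which is not a server.\<close>

lemma sent_by_server:
  assumes "u \<in> V - F"
  shows "(u, w, m) \<in> sent (\<sigma> i) \<Longrightarrow> \<exists>j<i. \<exists>h a. ev j = Exec u h a \<and> m \<in> outgoing h a"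
proof (induction i)
  case (Suc i)
  show ?case
  proof (cases "(u, w, m) \<in> sent (\<sigma> i)")
    case True
    with Suc show ?thesis using less_SucI by blast
  next
    case False
    with step_at[of i] show ?thesis
      by (cases rule: step.cases) (use Suc.prems assms sender_not_server in auto)
  qed
qed (simp add: initial init_def)

lemma sent_by_sender:
  assumes "c \<notin> F"
  shows "(c, w, m) \<in> sent (\<sigma> i) \<Longrightarrow> \<exists>j<i. \<exists>a. ev j = Broadcast a \<and> m = BCAST a"
proof (induction i)
  case (Suc i)
  show ?case
  proof (cases "(c, w, m) \<in> sent (\<sigma> i)")
    case True
    with Suc show ?thesis using less_SucI by blast
  next
    case False
    with step_at[of i] show ?thesis
      by (cases rule: step.cases) (use Suc.prems assms sender_not_server in auto)
  qed
qed (simp add: initial init_def)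

text \<open>Authentication as an invariant: a \<open>Receive\<close> between correct nodes requires
  the message to be in \<open>sent\<close> already, and \<open>sent\<close> never shrinks.\<close>

lemma rcvd_sent:
  assumes "u \<notin> F" "v \<notin> F"
  shows "(u, m) \<in> rcvd (node (\<sigma> i) v) \<Longrightarrow> (u, v, m) \<in> sent (\<sigma> i)"
proof (induction i)
  case (Suc i)
  have upd: "rcvd (update h l) = rcvd l" for h and l :: "('n, 'a) node_state"
    by (cases h) auto
  have "(u, v, m) \<in> sent (\<sigma> i)"
    using step_at[of i]
    by (cases rule: step.cases) (use Suc assms in \<open>auto simp: upd split: if_splits\<close>)
  then show ?case using sent_mono[of i "Suc i"] by auto
qed (simp add: initial init_def)

lemma rcvd_ECHO:
  assumes "u \<in> V - F" "v \<notin> F" "(u, ECHO a) \<in> rcvd (node (\<sigma> i) v)"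
  shows "\<exists>j<i. ev j = Exec u Echo a"
proof -
  obtain j h b where "j < i" "ev j = Exec u h b" "ECHO a \<in> outgoing h b"
    using sent_by_server[of u v "ECHO a" i] rcvd_sent[of u v "ECHO a" i] assms by blast
  then show ?thesis by (cases h) auto
qed

text \<open>The strict \<open>j < i\<close> is what lets the induction on time in
  \<open>ready_echo_quorum\<close> descend.\<close>

lemma rcvd_READY:
  assumes "u \<in> V - F" "v \<notin> F" "(u, READY a) \<in> rcvd (node (\<sigma> i) v)"
  shows "\<exists>j<i. readies j u a"
proof -
  obtain j h b where "j < i" "ev j = Exec u h b" "READY a \<in> outgoing h b"
    using sent_by_server[of u v "READY a" i] rcvd_sent[of u v "READY a" i] assms by blast
  then show ?thesis unfolding readies_def by (cases h) auto
qed

lemma exec_Echo_broadcast: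
  assumes "ev i = Exec v Echo a" "c \<notin> F"
  shows "\<exists>j<i. ev j = Broadcast a"
  using exec_enabled[OF assms(1)] rcvd_sent[of c v "BCAST a" i]
    sent_by_sender[of v "BCAST a" i] assms(2) by auto

section \<open>Flags as records of past events\<close>

lemma echoed_iff:
  assumes "v \<in> V - F"
  shows "echoed (node (\<sigma> i) v) \<longleftrightarrow> (\<exists>j<i. \<exists>a. ev j = Exec v Echo a)"
proof (induction i)
  case (Suc i)
  have "echoed (node (\<sigma> (Suc i)) v) \<longleftrightarrow> echoed (node (\<sigma> i) v) \<or> (\<exists>a. ev i = Exec v Echo a)"
    using step_at[of i]
  proof (cases rule: step.cases)
    case (exec w h a)
    then show ?thesis by (cases h) auto
  qed (use assms in auto)
  with Suc show ?case by (auto simp: less_Suc_eq)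
qed (simp add: initial init_def)

lemma ready_iff:
  assumes "v \<in> V - F"
  shows "ready (node (\<sigma> i) v) \<longleftrightarrow> (\<exists>j<i. \<exists>a. readies j v a)"
proof (induction i)
  case (Suc i)
  have "ready (node (\<sigma> (Suc i)) v) \<longleftrightarrow>
      ready (node (\<sigma> i) v) \<or> (\<exists>a. readies i v a)"
    using step_at[of i]
  proof (cases rule: step.cases)
    case (exec w h a)
    then show ?thesis unfolding readies_def by (cases h) auto
  qed (use assms in \<open>auto simp: readies_def\<close>)
  with Suc show ?case by (auto simp: less_Suc_eq)
qed (simp add: initial init_def)

lemma delivered_iff:
  assumes "v \<in> V - F"
  shows "delivered (node (\<sigma> i) v) \<longleftrightarrow> (\<exists>j<i. \<exists>a. ev j = Exec v Deliver a)"
proof (induction i)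
  case (Suc i)
  have "delivered (node (\<sigma> (Suc i)) v) \<longleftrightarrow>
      delivered (node (\<sigma> i) v) \<or> (\<exists>a. ev i = Exec v Deliver a)"
    using step_at[of i]
  proof (cases rule: step.cases)
    case (exec w h a)
    then show ?thesis by (cases h) auto
  qed (use assms in auto)
  with Suc show ?case by (auto simp: less_Suc_eq)
qed (simp add: initial init_def)

text \<open>The earlier of two echoes would set \<open>echoed\<close> and so disable the later
  one.\<close>

lemma echo_unique:
  assumes "ev i = Exec v Echo a" "ev j = Exec v Echo b"
  shows "i = j"
proof -
  have "\<not> k < l" if "ev k = Exec v Echo x" "ev l = Exec v Echo y" for k l x y
    using exec_enabled[OF that(2)] echoed_iff[of v l] that(1) by auto
  then show ?thesis using assms by (meson linorder_neqE_nat)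
qed

lemma deliver_unique:
  assumes "ev i = Exec v Deliver a" "ev j = Exec v Deliver b"
  shows "i = j"
proof -
  have "\<not> k < l" if "ev k = Exec v Deliver x" "ev l = Exec v Deliver y" for k l x y
    using exec_enabled[OF that(2)] delivered_iff[of v l] that(1) by auto
  then show ?thesis using assms by (meson linorder_neqE_nat)
qed

section \<open>Progress from reliable channels and fairness\<close>

lemma eventually_rcvd:
  assumes "u \<in> (C \<union> V) - F" "v \<in> V - F" "(u, v, m) \<in> sent (\<sigma> i)"
  shows "\<exists>j. \<forall>k\<ge>j. (u, m) \<in> rcvd (node (\<sigma> k) v)"
proof -
  obtain j where j: "ev j = Receive u v m"
    using reliable[of u v m i] assms by blast
  have "(u, m) \<in> rcvd (node (\<sigma> (Suc j)) v)"
    using step_at[of j] by (cases rule: step.cases) (use j in auto)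
  then show ?thesis using rcvd_mono[of v "Suc j"] assms by blast
qed

lemma eventually_rcvd_all:
  assumes "U \<subseteq> V - F" "v \<in> V - F" "\<And>u. u \<in> U \<Longrightarrow> \<exists>i. (u, v, m) \<in> sent (\<sigma> i)"
  shows "\<exists>j. \<forall>k\<ge>j. \<forall>u\<in>U. (u, m) \<in> rcvd (node (\<sigma> k) v)"
proof -
  have "\<forall>u\<in>U. \<exists>j. \<forall>k\<ge>j. (u, m) \<in> rcvd (node (\<sigma> k) v)"
    using eventually_rcvd[of _ v m] assms by blast
  then obtain f where f: "\<And>u k. u \<in> U \<Longrightarrow> f u \<le> k \<Longrightarrow> (u, m) \<in> rcvd (node (\<sigma> k) v)"
    by metis
  have fin: "finite U" using assms(1) finite_V finite_subset by blast
  show ?thesis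
  proof (intro exI allI impI ballI)
    \<comment> \<open>The sum of the reception times over the finite set \<open>U\<close> bounds
      each of them, hence is a common bound.\<close>
    fix k u assume "sum f U \<le> k" "u \<in> U"
    then show "(u, m) \<in> rcvd (node (\<sigma> k) v)"
      using f member_le_sum[of u U f] fin by fastforce
  qed
qed

text \<open>If \<open>v\<close> never echoed, its flag would stay false and the handler for
  \<open>a\<close> would stay enabled, against fairness. Only some value \<open>b\<close> is
  obtained, since \<open>v\<close> may have echoed another value first. The next three lemmas follow
  the same pattern.\<close>

lemma eventually_echo:
  assumes "v \<in> V - F" "\<And>k. k \<ge> i \<Longrightarrow> (c, BCAST a) \<in> rcvd (node (\<sigma> k) v)"
  shows "\<exists>j b. ev j = Exec v Echo b"
proof (rule ccontr)
  assume "\<not> ?thesis"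
  then show False using fair[of v i Echo a] assms echoed_iff[of v] by auto
qed

lemma eventually_ready_quorum:
  assumes "quorum V S U" "v \<in> U" "v \<in> V - F"
    "\<And>k. k \<ge> i \<Longrightarrow> \<forall>u\<in>U. (u, ECHO a) \<in> rcvd (node (\<sigma> k) v)"
  shows "\<exists>j b. readies j v b"
proof (rule ccontr)
  assume n: "\<not> ?thesis"
  have "\<exists>j. ev j = Exec v Ready_Quorum a"
    by (rule fair[of v i]) (use assms n ready_iff[of v] in auto)
  then show False using n by (auto simp: readies_def)
qed

lemma eventually_ready_blocking:
  assumes "B \<subseteq> V" "B \<noteq> {}" "blocking S v B" "v \<in> V - F"
    "\<And>k. k \<ge> i \<Longrightarrow> \<forall>u\<in>B. (u, READY a) \<in> rcvd (node (\<sigma> k) v)"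
  shows "\<exists>j b. readies j v b"
proof (rule ccontr)
  assume n: "\<not> ?thesis"
  have "\<exists>j. ev j = Exec v Ready_Blocking a"
    by (rule fair[of v i]) (use assms n ready_iff[of v] in auto)
  then show False using n by (auto simp: readies_def)
qed

lemma eventually_deliver:
  assumes "quorum V S U" "v \<in> U" "v \<in> V - F"
    "\<And>k. k \<ge> i \<Longrightarrow> \<forall>u\<in>U. (u, READY a) \<in> rcvd (node (\<sigma> k) v)"
  shows "\<exists>j b. ev j = Exec v Deliver b"
proof (rule ccontr)
  assume n: "\<not> ?thesis"
  have "\<exists>j. ev j = Exec v Deliver a"
    by (rule fair[of v i]) (use assms n delivered_iff[of v] in auto)
  then show False using n by auto
qed

end

section \<open>Agreement through the intact servers\<close>

locale stellar_intact = stellar +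
  fixes I
  assumes quorum_int: "quorum_intersection V S"
    and I_correct: "I \<subseteq> V - F" and I_quorum: "quorum V S I"
    and I_quorum_int: "quorum_intersection I (projection S I)"
begin

lemma quorum_meets_intact: "quorum V S U \<Longrightarrow> U \<inter> I \<noteq> {}"
  using quorum_int I_quorum unfolding quorum_intersection_def by blast

text \<open>Both traces on \<open>I\<close> are non-empty, hence quorums of the projection, which
  has quorum intersection. Intersection in \<open>S\<close> alone could yield a faulty common
  server.\<close>

lemma quorums_meet_in_intact:
  assumes "quorum V S U" "quorum V S U'"
  shows "U \<inter> U' \<inter> I \<noteq> {}"
proof -
  have "quorum I (projection S I) (U \<inter> I)" "quorum I (projection S I) (U' \<inter> I)"
    using assms quorum_meets_intact quorum_projection by blast+
  then show ?thesis using I_quorum_int unfolding quorum_intersection_def by blast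
qed

text \<open>Induction on time: readiness through a blocking set goes back to an earlier readiness of
  an intact server for the same value, until an echo quorum is reached. Echoes are claimed only on
  \<open>U \<inter> I\<close>, since faulty members may send \<open>ECHO\<close> without executing
  the handler.\<close>

lemma ready_echo_quorum:
  assumes "v \<in> I" "readies i v a"
  shows "\<exists>U. quorum V S U \<and> (\<forall>u\<in>U \<inter> I. \<exists>j<i. ev j = Exec u Echo a)"
  using assms
proof (induction i arbitrary: v rule: less_induct)
  case (less i)
  have v: "v \<in> V - F" using less.prems I_correct by blast
  from less.prems(2) consider "ev i = Exec v Ready_Quorum a" | "ev i = Exec v Ready_Blocking a"
    unfolding readies_def by blast
  then show ?case
  proof cases
    case 1
    then obtain U where U: "quorum V S U" "\<forall>u\<in>U. (u, ECHO a) \<in> rcvd (node (\<sigma> i) v)"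
      using exec_enabled(2)[OF 1] by auto
    then have "\<forall>u\<in>U \<inter> I. \<exists>j<i. ev j = Exec u Echo a"
      using rcvd_ECHO[of _ v a i] v I_correct by blast
    then show ?thesis using U by blast
  next
    case 2
    then obtain B where B: "blocking S v B" "\<forall>u\<in>B. (u, READY a) \<in> rcvd (node (\<sigma> i) v)"
      using exec_enabled(2)[OF 2] by auto
    \<comment> \<open>Some slice of \<open>v\<close> lies inside the quorum \<open>I\<close>, and
      \<open>B\<close> has to hit it there.\<close>
    obtain u where u: "u \<in> B" "u \<in> I"
      using blocking_meets_quorum[OF I_quorum _ B(1)] less.prems by blast
    then obtain j where j: "j < i" "readies j u a"
      using rcvd_READY[of u v a i] v I_correct B by blast
    then show ?thesis using less.IH[OF j(1) u(2) j(2)] by (meson less_trans)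
  qed
qed

lemma ready_agree:
  assumes "v \<in> I" "readies i v a"
    and "v' \<in> I" "readies i' v' a'"
  shows "a = a'"
proof -
  obtain U U' where "quorum V S U" "\<forall>u\<in>U \<inter> I. \<exists>j<i. ev j = Exec u Echo a"
    and "quorum V S U'" "\<forall>u\<in>U' \<inter> I. \<exists>j<i'. ev j = Exec u Echo a'"
    using ready_echo_quorum[OF assms(1,2)] ready_echo_quorum[OF assms(3,4)] by blast
  then obtain u j j' where "ev j = Exec u Echo a" "ev j' = Exec u Echo a'"
    using quorums_meet_in_intact[of U U'] by blast
  then show ?thesis using echo_unique[of j u a j' a'] by auto
qed

lemma ready_broadcast:
  assumes "v \<in> I" "readies i v a" "c \<notin> F"
  shows "\<exists>j<i. ev j = Broadcast a"
proof -
  obtain u j where "j < i" "ev j = Exec u Echo a"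
    using ready_echo_quorum[OF assms(1,2)] quorum_meets_intact by blast
  then show ?thesis using exec_Echo_broadcast[of j u a] assms(3) by (meson less_trans)
qed

text \<open>The delivering server is correct but perhaps not intact; what it received from intact
  members of its quorum is authentic all the same. This carries agreement from intact to all correct
  servers.\<close>

lemma deliver_ready_quorum:
  assumes "ev i = Exec v Deliver a"
  shows "\<exists>U. quorum V S U \<and>
    (\<forall>u\<in>U \<inter> I. \<exists>j<i. readies j u a)"
proof -
  note en = exec_enabled[OF assms]
  then obtain U where U: "quorum V S U" "\<forall>u\<in>U. (u, READY a) \<in> rcvd (node (\<sigma> i) v)"
    by auto
  then have "\<forall>u\<in>U \<inter> I. \<exists>j<i. readies j u a"
    using rcvd_READY[of _ v a i] en(1) I_correct by blast
  then show ?thesis using U by blast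
qed

lemma deliver_ready:
  assumes "ev i = Exec v Deliver a"
  obtains u j where "u \<in> I" "j < i" "readies j u a"
  using deliver_ready_quorum[OF assms] quorum_meets_intact by blast

lemma deliver_agree:
  assumes "ev i = Exec v Deliver a" "ev i' = Exec v' Deliver a'"
  shows "a = a'"
  using deliver_ready[OF assms(1)] deliver_ready[OF assms(2)] ready_agree by metis

lemma deliver_broadcast:
  assumes "ev i = Exec v Deliver a" "c \<notin> F"
  shows "\<exists>j<i. ev j = Broadcast a"
  using deliver_ready[OF assms(1)] ready_broadcast[OF _ _ assms(2)] by (metis less_trans)

section \<open>Validity and totality for intact servers\<close>

lemma eventually_rcvd_READY:
  assumes "R \<subseteq> I" "v \<in> V - F"
    "\<And>u. u \<in> R \<Longrightarrow> \<exists>j. readies j u a"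
  shows "\<exists>j. \<forall>k\<ge>j. \<forall>u\<in>R. (u, READY a) \<in> rcvd (node (\<sigma> k) v)"
proof (rule eventually_rcvd_all)
  fix u assume "u \<in> R"
  then obtain j where "readies j u a"
    using assms(3) by blast
  then show "\<exists>i. (u, v, READY a) \<in> sent (\<sigma> i)"
    using exec_sends[of j u _ a "READY a" v] assms(2) unfolding readies_def by auto
qed (use assms I_correct in auto)

text \<open>The set \<open>I\<close> itself serves as the quorum on whose \<open>READY\<close>
  messages \<open>v\<close> can deliver. This is the last stage of both validity and
  totality.\<close>

lemma all_ready_all_deliver:
  assumes "\<And>u. u \<in> I \<Longrightarrow> \<exists>j. readies j u a" "v \<in> I"
  shows "\<exists>j b. ev j = Exec v Deliver b"
proof -
  have v: "v \<in> V - F" using assms(2) I_correct by blast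
  obtain j where "\<forall>k\<ge>j. \<forall>u\<in>I. (u, READY a) \<in> rcvd (node (\<sigma> k) v)"
    using eventually_rcvd_READY[of I v a] v assms(1) by blast
  then show ?thesis using eventually_deliver[OF I_quorum assms(2) v] by blast
qed

lemma validity:
  assumes c: "c \<notin> F" and bc: "ev i = Broadcast a" and v: "v \<in> I"
  shows "\<exists>j. ev j = Exec v Deliver a"
proof -
  have echo: "\<exists>j. ev j = Exec u Echo a" if "u \<in> I" for u
  proof -
    have u: "u \<in> V - F" using that I_correct by blast
    obtain j where "\<forall>k\<ge>j. (c, BCAST a) \<in> rcvd (node (\<sigma> k) u)"
      using eventually_rcvd[of c u "BCAST a" "Suc i"] broadcast_sends[OF bc, of u] c u sender
      by blast
    then obtain k b where k: "ev k = Exec u Echo b" using eventually_echo[OF u] by blast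
    \<comment> \<open>Fairness leaves the value open; it is fixed because a correct sender
      broadcasts only one. The later stages fix theirs in the same way.\<close>
    then have "b = a" using exec_Echo_broadcast[OF k c] broadcast_unique[OF c bc] by blast
    then show ?thesis using k by blast
  qed
  have ready: "\<exists>j. readies j u a" if "u \<in> I" for u
  proof -
    have u: "u \<in> V - F" using that I_correct by blast
    have "\<exists>i. (w, u, ECHO a) \<in> sent (\<sigma> i)" if "w \<in> I" for w
      using echo[OF that] exec_sends[of _ w Echo a "ECHO a" u] u by auto
    then obtain j where "\<forall>k\<ge>j. \<forall>w\<in>I. (w, ECHO a) \<in> rcvd (node (\<sigma> k) u)"
      using eventually_rcvd_all[OF I_correct u] by blast
    then obtain k b where k: "readies k u b"
      using eventually_ready_quorum[OF I_quorum \<open>u \<in> I\<close> u] by blast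
    then have "b = a" using ready_broadcast[OF that k c] broadcast_unique[OF c bc] by blast
    then show ?thesis using k by blast
  qed
  obtain j b where j: "ev j = Exec v Deliver b"
    using all_ready_all_deliver[OF ready v] by blast
  then have "b = a" using deliver_broadcast[OF j c] broadcast_unique[OF c bc] by blast
  then show ?thesis using j by blast
qed

lemma totality:
  assumes "ev i = Exec v Deliver a" "w \<in> I"
  shows "\<exists>j b. ev j = Exec w Deliver b"
proof -
  define R where "R = {u \<in> I. \<exists>j. readies j u a}"
  obtain U where U: "quorum V S U" "U \<inter> I \<subseteq> R"
    using deliver_ready_quorum[OF assms(1)] unfolding R_def by blast
  then have R: "R \<subseteq> I" "R \<noteq> {}" using quorum_meets_intact[of U] unfolding R_def by blast+
  have unblocked: "\<not> blocking S u R" if "u \<in> I - R" for u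
  proof
    assume bl: "blocking S u R"
    have u: "u \<in> V - F" using that I_correct by blast
    obtain j where "\<forall>k\<ge>j. \<forall>w\<in>R. (w, READY a) \<in> rcvd (node (\<sigma> k) u)"
      using eventually_rcvd_READY[OF R(1) u, of a] unfolding R_def by blast
    then obtain k b where k: "readies k u b"
      using eventually_ready_blocking[OF _ R(2) bl u] R(1) I_correct by blast
    \<comment> \<open>A blocked \<open>u\<close> becomes ready for some \<open>b\<close>; comparison
      with any member of \<open>R\<close> forces \<open>b = a\<close>, which would put
      \<open>u\<close> into \<open>R\<close>.\<close>
    obtain u' k' where "u' \<in> I" "readies k' u' a"
      using R unfolding R_def by blast
    then have "b = a" using ready_agree[of u k b u' k' a] k that by blast
    then show False using k that unfolding R_def by blast
  qed
  have "I - R = {}"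
  proof (rule ccontr)
    assume "I - R \<noteq> {}"
    then have "quorum I (projection S I) (I - R)"
      using quorum_projection_Diff[of I R S] unblocked by blast
    moreover have "quorum I (projection S I) (U \<inter> I)"
      using quorum_projection[OF U(1)] quorum_meets_intact[OF U(1)] by blast
    ultimately have "(I - R) \<inter> (U \<inter> I) \<noteq> {}"
      using I_quorum_int unfolding quorum_intersection_def by blast
    then show False using U(2) by blast
  qed
  then have "\<exists>j. readies j u a" if "u \<in> I" for u
    using that unfolding R_def by blast
  then show ?thesis using all_ready_all_deliver assms(2) by blast
qed

end

theorem theorem13:
  fixes C V F :: "'n set" and c :: 'n and S :: "'n slices"
    and \<sigma> :: "nat \<Rightarrow> ('n, 'a) state" and ev :: "nat \<Rightarrow> ('n, 'a) event"
  assumes "C \<inter> V = {}" and "finite V" and "V \<noteq> {}" and "c \<in> C" and "F \<subseteq> C \<union> V"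
    and "fbqs V S" and "quorum_intersection V S"
    and "stellar_execution C V c S F \<sigma> ev"
    and "intact V S (F \<inter> V) \<noteq> {}"
  shows "weakly_reliable_byzantine_broadcast V c S F ev"
proof -
  define I where "I = intact V S (F \<inter> V)"
  have "intact_candidate V S (F \<inter> V) I"
    unfolding I_def by (rule intact_greatest(1)[OF assms(2,7)])
  moreover have "I \<noteq> {}" unfolding I_def by (rule assms(9))
  \<comment> \<open>The candidate condition makes \<open>I\<close> a quorum only if it is non-empty,
    which is where the existence of an intact server enters.\<close>
  ultimately have "I \<subseteq> V - F" "quorum V S I" "quorum_intersection I (projection S I)"
    unfolding intact_candidate_def by blast+
  then interpret stellar_intact C V F c S \<sigma> ev I
    using assms(1,2,4,7,8) by unfold_locales
  have "validity_for_intact c F I ev"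
    unfolding validity_for_intact_def using validity by blast
  moreover have "no_duplication V F ev"
    unfolding no_duplication_def using deliver_unique by blast
  moreover have "integrity V c F ev"
    unfolding integrity_def using deliver_broadcast by blast
  moreover have "consistency V F ev"
    unfolding consistency_def using deliver_agree by blast
  moreover have "totality_for_intact V F I ev"
    unfolding totality_for_intact_def using totality by blast
  ultimately show ?thesis
    unfolding weakly_reliable_byzantine_broadcast_def I_def by blast
qed

end
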